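(* Let $\mathcal{M}=(Q,\Sigma,\cdot,\circ)$ be an invertible Mealy automaton admitting a finite nucleus automaton $\mathcal{N}$. Let $L\subseteq\Sigma^\omega$ be the language recognized by the Büchi automaton $\mathcal{B}(\mathcal{N})$ in which every state except the sink-state is accepting. Then every singular point of $\mathcal{M}$ is cofinal with some word in $L$. Conversely, every word in $L$ is a singular point. In particular, if $L=\emptyset$ then the set $\kappa$ of singular points is empty.
   Context: A Mealy automaton is $\mathcal{M}=(Q,\Sigma,\cdot,\circ)$ with finite nonempty sets $Q$ (states) and $\Sigma$ (alphabet), a transition function $(q,a)\mapsto q\cdot a\in Q$ and a production function $(q,a)\mapsto q\circ a\in\Sigma$; a transition is written $q\xrightarrow{a|b}p$ when $q\cdot a=p$, $q\circ a=b$. Extend by $q\circ(a_1\cdots a_n)=(q\circ a_1)\big((q\cdot a_1)\circ(a_2\cdots a_n)\big)$. It is invertible if each $a\mapsto q\circ a$ is a permutation of $\Sigma$; then each $q$ acts as an automorphism of the rooted tree $\Sigma^*$, $\langle\mathcal{M}\rangle$ is the group generated by these automorphisms, with identity $1$, and it acts on $\Sigma^*$ and on the boundary $\Sigma^\omega$. For $g\in\langle\mathcal{M}\rangle$ and $v\in\Sigma^*$, $g\cdot v\in\langle\mathcal{M}\rangle$ denotes the unique element with $g\circ(vw)=(g\circ v)\big((g\cdot v)\circ w\big)$ for all $w\in\Sigma^*$. Nucleus: a finite set $\mathcal{K}\subset\langle\mathcal{M}\rangle$ such that for every $g\in\langle\mathcal{M}\rangle$ there is an integer $n$ with $g\cdot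 v\in\mathcal{K}$ for all words $v$ of length at least $n$, and which is closed under $g\mapsto g\cdot a$ ($a\in\Sigma$). The nucleus automaton $\mathcal{N}$ is the Mealy automaton with stateset $\mathcal{K}$, alphabet $\Sigma$ and transitions $g\xrightarrow{a\,|\,g\circ a}g\cdot a$. Its sink-state is the identity $1\in\mathcal{K}$. Stable automaton: $\mathcal{B}(\mathcal{N})$ has the same states as $\mathcal{N}$ and a transition $g\xrightarrow{a}h$ exactly when $g\xrightarrow{a|a}h$ is a transition of $\mathcal{N}$. It is used as a Büchi automaton, all states being allowed as initial states: an infinite word is recognized if it labels an infinite path that visits accepting states infinitely often. Two words $\xi,\eta\in\Sigma^\omega$ are cofinal if there is $k$ such that they agree at all positions $\ge k$. Singular points: $\xi\in\Sigma^\omega$ is singular if the map $\xi\mapsto\mathrm{Stab}(\xi)=\{g\in\langle\mathcal{M}\rangle:g\circ\xi=\xi\}$ from $\Sigma^\omega$ (product topology) to the space of subgroups of $\langle\mathcal{M}\rangle$ (topology induced from $\{0,1\}^{\langle\mathcal{M}\rangle}$) is not continuous at $\xi$; $\kappa$ is the set of singular points. *)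

theory Defs
  imports
    "HOL-Analysis.Analysis"
    "HOL-Algebra.Bij"
    "HOL-Algebra.Generated_Groups"
begin

text \<open>
  The alphabet is a type of class \<open>finite\<close> (hence finite and nonempty); it is the same for an
  automaton and for its nucleus automaton.  The stateset is an explicit carrier, because the
  states of a nucleus automaton are particular elements of a group of functions on words.
\<close>

record ('q, 'a) mealy =
  states :: "'q set"
  transition :: "'q \<Rightarrow> 'a \<Rightarrow> 'q"
  production :: "'q \<Rightarrow> 'a \<Rightarrow> 'a"

definition mealy_automaton :: "('q, 'a::finite) mealy \<Rightarrow> bool" where
  "mealy_automaton M \<longleftrightarrow>
     finite (states M) \<and> states M \<noteq> {} \<and> (\<forall>q\<in>states M. \<forall>a. transition M q a \<in> states M)"

definition mealy_invertible :: "('q, 'a::finite) mealy \<Rightarrow> bool" where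
  "mealy_invertible M \<longleftrightarrow> (\<forall>q\<in>states M. bij (production M q))"

primrec act :: "('q, 'a::finite) mealy \<Rightarrow> 'q \<Rightarrow> 'a list \<Rightarrow> 'a list" where
  "act M q [] = []"
| "act M q (a # w) = production M q a # act M (transition M q a) w"

text \<open>
  The product in the group is composition of functions.  The library's \<open>subgroup_generated\<close> intersects the
  generating set with the carrier; for an invertible automaton this removes nothing.
\<close>

definition mealy_group :: "('q, 'a::finite) mealy \<Rightarrow> ('a list \<Rightarrow> 'a list) monoid" where
  "mealy_group M = subgroup_generated (BijGroup UNIV) (act M ` states M)"

definition state_at ::
    "('q, 'a::finite) mealy \<Rightarrow> ('a list \<Rightarrow> 'a list) \<Rightarrow> 'a list \<Rightarrow> ('a list \<Rightarrow> 'a list)" where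
  "state_at M g v =
     (THE h. h \<in> carrier (mealy_group M) \<and> (\<forall>w. g (v @ w) = g v @ h w))"

definition is_nucleus :: "('q, 'a::finite) mealy \<Rightarrow> ('a list \<Rightarrow> 'a list) set \<Rightarrow> bool" where
  "is_nucleus M K \<longleftrightarrow>
     finite K \<and> K \<subseteq> carrier (mealy_group M) \<and>
     (\<forall>g\<in>carrier (mealy_group M). \<exists>n. \<forall>v. n \<le> length v \<longrightarrow> state_at M g v \<in> K) \<and>
     (\<forall>g\<in>K. \<forall>a. state_at M g [a] \<in> K)"

text \<open>Elements of the group preserve length, so \<open>g [a]\<close> is a one-letter word.\<close>

definition nucleus_automaton ::
    "('q, 'a::finite) mealy \<Rightarrow> ('a list \<Rightarrow> 'a list) set \<Rightarrow> ('a list \<Rightarrow> 'a list, 'a) mealy" where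
  "nucleus_automaton M K =
     \<lparr>states = K, transition = (\<lambda>g a. state_at M g [a]), production = (\<lambda>g a. hd (g [a]))\<rparr>"

record ('q, 'a) buchi =
  initial :: "'q set"
  edges :: "('q \<times> 'a \<times> 'q) set"
  accepting :: "'q set"

definition buchi_language :: "('q, 'a) buchi \<Rightarrow> (nat \<Rightarrow> 'a) set" where
  "buchi_language B =
     {\<xi>. \<exists>\<pi>. \<pi> 0 \<in> initial B \<and> (\<forall>i. (\<pi> i, \<xi> i, \<pi> (Suc i)) \<in> edges B) \<and>
          (\<exists>\<^sub>\<infinity>i. \<pi> i \<in> accepting B)}"

text \<open>The stable automaton of \<open>N\<close>, with accepting states \<open>F\<close>.\<close>

definition stable_automaton :: "('q, 'a) mealy \<Rightarrow> 'q set \<Rightarrow> ('q, 'a) buchi" where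
  "stable_automaton N F =
     \<lparr>initial = states N,
      edges = {(g, a, h). g \<in> states N \<and> transition N g a = h \<and> production N g a = a},
      accepting = F\<rparr>"

definition cofinal_words :: "(nat \<Rightarrow> 'a) \<Rightarrow> (nat \<Rightarrow> 'a) \<Rightarrow> bool" where
  "cofinal_words \<xi> \<eta> \<longleftrightarrow> (\<exists>k. \<forall>i\<ge>k. \<xi> i = \<eta> i)"

text \<open>
  The action on the boundary: letter \<open>n\<close> of the image of \<open>\<xi>\<close> is the last letter of the image of
  the prefix of \<open>\<xi>\<close> of length \<open>Suc n\<close>.  As elements of the group preserve length and
  prefixes, the image of \<open>\<xi>\<close> is the infinite word whose prefixes are the images of those of \<open>\<xi>\<close>.
\<close>

definition boundary_act :: "('a list \<Rightarrow> 'a list) \<Rightarrow> (nat \<Rightarrow> 'a) \<Rightarrow> (nat \<Rightarrow> 'a)" where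
  "boundary_act g \<xi> = (\<lambda>n. g (map \<xi> [0..<Suc n]) ! n)"

definition stabilizer :: "('q, 'a::finite) mealy \<Rightarrow> (nat \<Rightarrow> 'a) \<Rightarrow> ('a list \<Rightarrow> 'a list) set" where
  "stabilizer M \<xi> = {g \<in> carrier (mealy_group M). boundary_act g \<xi> = \<xi>}"

definition boundary_topology :: "(nat \<Rightarrow> 'a) topology" where
  "boundary_topology = product_topology (\<lambda>_. discrete_topology UNIV) UNIV"

text \<open>
  The set of subgroups, with the topology induced by sending a subgroup to its characteristic
  function in the product of copies of the discrete two-point space.
\<close>

definition subgroup_topology :: "('g, 'm) monoid_scheme \<Rightarrow> 'g set topology" where
  "subgroup_topology G =
     pullback_topology {H. subgroup H G} (\<lambda>H. \<lambda>g\<in>carrier G. g \<in> H)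
       (product_topology (\<lambda>_. discrete_topology (UNIV :: bool set)) (carrier G))"

definition singular_points :: "('q, 'a::finite) mealy \<Rightarrow> (nat \<Rightarrow> 'a) set" where
  "singular_points M =
     {\<xi>. \<not> topcontinuous_at boundary_topology (subgroup_topology (mealy_group M))
            (stabilizer M) \<xi>}"

end

theory Submission
  imports Defs
begin

text \<open>
  A word \<open>\<xi>\<close> is singular exactly when some group element \<open>g\<close> fixes \<open>\<xi>\<close> but fixes no cylinder around
  it pointwise: membership of a single \<open>g\<close> in the stabilizer is a clopen condition in the space of
  subgroups, and a point moved by \<open>g\<close> has a whole cylinder of points moved by \<open>g\<close>, so continuity
  can only fail through elements that fix \<open>\<xi>\<close>.  If \<open>g\<close> fixes \<open>\<xi>\<close>, then it fixes the cylinder of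
  a prefix \<open>v\<close> pointwise if and only if the state of \<open>g\<close> at \<open>v\<close> is the identity.  Hence \<open>\<xi>\<close> is
  singular if and only if some \<open>g\<close> fixing \<open>\<xi>\<close> has only nontrivial states along \<open>\<xi>\<close>
  (\<open>singular_iff\<close>).

  Those states form, from the moment they lie in the nucleus, a path of the stable automaton
  labelled by a tail of \<open>\<xi>\<close>.  To conclude that \<open>\<xi>\<close> itself, and not just a shift of it, is cofinal
  with a recognized word, the path has to be extended backwards to time \<open>0\<close> without changing the
  positions of the letters.  The path lives in a finite set, so it returns to some state, and
  running backwards around that cycle supplies as many earlier transitions as are required
  (\<open>recurrent_path_realign\<close>).

  Conversely, an infinite path of the stable automaton is the sequence of states of its first
  state \<open>g\<close> along its label \<open>\<eta>\<close>, and \<open>g\<close> fixes \<open>\<eta>\<close>.  The identity is absorbing, so a path that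
  meets nontrivial states infinitely often never meets the identity, which makes \<open>\<eta>\<close> singular.
\<close>

section \<open>Continuity of a map into the space of subgroups\<close>

text \<open>
  A basic open set of the space of subgroups constrains the membership of finitely many elements
  only, so a map into this space is continuous at \<open>x\<close> as soon as each single membership is locally
  constant at \<open>x\<close>.
\<close>

lemma topcontinuous_at_subgroup_topology_iff:
  fixes f :: "'x \<Rightarrow> 'g set"
  shows "topcontinuous_at X (subgroup_topology G) f x \<longleftrightarrow>
     x \<in> topspace X \<and> (\<forall>y\<in>topspace X. subgroup (f y) G) \<and>
     (\<forall>g\<in>carrier G. \<exists>U. openin X U \<and> x \<in> U \<and> (\<forall>y\<in>U. g \<in> f y \<longleftrightarrow> g \<in> f x))"
    (is "?L \<longleftrightarrow> ?A \<and> ?B \<and> ?C")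
proof -
  let ?c = "\<lambda>H. \<lambda>g\<in>carrier G. g \<in> H"
  let ?T = "product_topology (\<lambda>_. discrete_topology (UNIV :: bool set)) (carrier G)"
  have top: "topspace (subgroup_topology G) = {H. subgroup H G}"
    by (auto simp: subgroup_topology_def topspace_pullback_topology)
  have op: "openin (subgroup_topology G) V \<longleftrightarrow> (\<exists>W. openin ?T W \<and> V = ?c -` W \<inter> {H. subgroup H G})" for V
    by (simp add: subgroup_topology_def openin_pullback_topology)
  show ?thesis
  proof
    assume L: ?L
    then have A: ?A and B: ?B by (auto simp: topcontinuous_at_def top)
    have ?C
    proof
      fix g assume g: "g \<in> carrier G"
      define W where "W = {\<phi> \<in> topspace ?T. \<phi> g = (g \<in> f x)}"
      define V where "V = ?c -` W \<inter> {H. subgroup H G}"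
      have "openin ?T W"
        using openin_continuous_map_preimage
            [OF continuous_map_product_projection[OF g, of "\<lambda>_. discrete_topology (UNIV :: bool set)"],
             of "{g \<in> f x}"]
        by (simp add: W_def)
      then have "openin (subgroup_topology G) V"
        unfolding op V_def by blast
      moreover have mem: "f y \<in> V \<longleftrightarrow> (g \<in> f y \<longleftrightarrow> g \<in> f x)" if "y \<in> topspace X" for y
        using that B g by (auto simp: V_def W_def)
      moreover have "f x \<in> V" using mem A by simp
      ultimately obtain U where U: "openin X U" "x \<in> U" "\<forall>y\<in>U. f y \<in> V"
        using L unfolding topcontinuous_at_def by blast
      have "\<forall>y\<in>U. g \<in> f y \<longleftrightarrow> g \<in> f x"
        using U mem openin_subset[OF U(1)] by blast
      then show "\<exists>U. openin X U \<and> x \<in> U \<and> (\<forall>y\<in>U. g \<in> f y \<longleftrightarrow> g \<in> f x)"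
        using U by blast
    qed
    with A B show "?A \<and> ?B \<and> ?C" by blast
  next
    assume R: "?A \<and> ?B \<and> ?C"
    have "\<exists>U. openin X U \<and> x \<in> U \<and> (\<forall>y\<in>U. f y \<in> V)"
      if V: "openin (subgroup_topology G) V" "f x \<in> V" for V
    proof -
      obtain W where W: "openin ?T W" "V = ?c -` W \<inter> {H. subgroup H G}"
        using V op by blast
      then have "?c (f x) \<in> W" using V by auto
      then obtain B where B: "finite {g \<in> carrier G. B g \<noteq> UNIV}" "?c (f x) \<in> Pi\<^sub>E (carrier G) B"
        "Pi\<^sub>E (carrier G) B \<subseteq> W"
        using W(1) unfolding openin_product_topology_alt topspace_discrete_topology by meson
      let ?F = "{g \<in> carrier G. B g \<noteq> UNIV}"
      have "\<forall>g\<in>?F. \<exists>U. openin X U \<and> x \<in> U \<and> (\<forall>y\<in>U. g \<in> f y \<longleftrightarrow> g \<in> f x)"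
        using R by blast
      from bchoice[OF this] obtain U where U:
        "\<forall>g\<in>?F. openin X (U g) \<and> x \<in> U g \<and> (\<forall>y\<in>U g. g \<in> f y \<longleftrightarrow> g \<in> f x)"
        by blast
      let ?U = "topspace X \<inter> \<Inter>(U ` ?F)"
      have "openin X ?U"
        using B(1) U by (intro openin_Int_Inter) auto
      moreover have "x \<in> ?U" using U R by auto
      moreover have "f y \<in> V" if y: "y \<in> ?U" for y
      proof -
        have "(g \<in> f y) \<in> B g" if g: "g \<in> carrier G" for g
        proof (cases "B g = UNIV")
          case False
          then have "(g \<in> f y) = (g \<in> f x)" using U y g by blast
          moreover have "(g \<in> f x) \<in> B g" using B(2) g by (auto simp: PiE_iff)
          ultimately show ?thesis by simp
        qed simp
        then have "?c (f y) \<in> Pi\<^sub>E (carrier G) B" by (auto simp: PiE_iff)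
        then have "?c (f y) \<in> W" using B(3) by blast
        then show ?thesis using W(2) R y by simp
      qed
      ultimately show ?thesis by (intro exI[of _ ?U] conjI ballI)
    qed
    then show ?L
      using R by (auto simp: topcontinuous_at_def top)
  qed
qed

abbreviation initial_word :: "(nat \<Rightarrow> 'a) \<Rightarrow> nat \<Rightarrow> 'a list" where
  "initial_word \<xi> n \<equiv> map \<xi> [0..<n]"

text \<open>
  The cylinders form a neighbourhood base because a basic open set constrains finitely many
  letters, hence only letters of some initial word.
\<close>

lemma boundary_neighbourhood_iff:
  "(\<exists>U. openin boundary_topology U \<and> \<xi> \<in> U \<and> (\<forall>\<eta>\<in>U. P \<eta>)) \<longleftrightarrow>
   (\<exists>n. \<forall>\<eta>. initial_word \<eta> n = initial_word \<xi> n \<longrightarrow> P \<eta>)" (is "?L \<longleftrightarrow> ?R")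
proof
  assume ?L
  then obtain U where "openin boundary_topology U" "\<xi> \<in> U" and P: "\<forall>\<eta>\<in>U. P \<eta>" by blast
  then obtain B where B: "finite {i \<in> UNIV. B i \<noteq> (UNIV :: 'a set)}" "\<xi> \<in> Pi\<^sub>E UNIV B" "Pi\<^sub>E UNIV B \<subseteq> U"
    unfolding boundary_topology_def openin_product_topology_alt topspace_discrete_topology by meson
  then obtain n where n: "\<forall>i\<in>{i. B i \<noteq> UNIV}. i < n"
    using finite_nat_set_iff_bounded by auto
  have "P \<eta>" if "initial_word \<eta> n = initial_word \<xi> n" for \<eta>
  proof -
    have "\<eta> i \<in> B i" for i
    proof (cases "B i = UNIV")
      case False
      then have "i < n" using n by blast
      then have "\<eta> i = \<xi> i" using that by auto
      then show ?thesis using B(2) by auto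
    qed simp
    then show ?thesis using B(3) P by auto
  qed
  then show ?R by blast
next
  assume ?R
  then obtain n where n: "\<forall>\<eta>. initial_word \<eta> n = initial_word \<xi> n \<longrightarrow> P \<eta>" by blast
  let ?B = "\<lambda>i. if i < n then {\<xi> i} else UNIV"
  have "finite {i. ?B i \<noteq> UNIV}"
    by (rule finite_subset[of _ "{..<n}"]) auto
  then have "openin boundary_topology (Pi\<^sub>E UNIV ?B)"
    unfolding boundary_topology_def
    by (intro product_topology_basis) auto
  moreover have "\<xi> \<in> Pi\<^sub>E UNIV ?B" by auto
  moreover have "P \<eta>" if "\<eta> \<in> Pi\<^sub>E UNIV ?B" for \<eta>
  proof -
    have "\<eta> i = \<xi> i" if "i < n" for i
      using \<open>\<eta> \<in> Pi\<^sub>E UNIV ?B\<close> that by (auto simp: PiE_iff dest: spec[of _ i])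
    then show ?thesis using n by auto
  qed
  ultimately show ?L by blast
qed

section \<open>Tree automorphisms generated by an invertible automaton\<close>

locale invertible_mealy =
  fixes M :: "('q, 'a::finite) mealy"
  assumes automaton: "mealy_automaton M" and invertible: "mealy_invertible M"
begin

abbreviation G :: "('a list \<Rightarrow> 'a list) set" where
  "G \<equiv> carrier (mealy_group M)"

lemma act_length: "length (act M q w) = length w"
  by (induction w arbitrary: q) auto

lemma act_append:
  "q \<in> states M \<Longrightarrow> \<exists>p\<in>states M. \<forall>w. act M q (v @ w) = act M q v @ act M p w"
proof (induction v arbitrary: q)
  case (Cons a v)
  then have "transition M q a \<in> states M"
    using automaton by (auto simp: mealy_automaton_def)
  from Cons.IH[OF this] show ?case by auto
qed auto

lemma bij_act:
  assumes "q \<in> states M"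
  shows "bij (act M q)"
proof (rule bijI)
  have step: "transition M q a \<in> states M" "bij (production M q)" if "q \<in> states M" for q a
    using that automaton invertible by (auto simp: mealy_automaton_def mealy_invertible_def)
  have "act M q u = act M q v \<Longrightarrow> u = v" for u v
    using assms
  proof (induction u arbitrary: v q)
    case Nil
    then show ?case by (cases v) auto
  next
    case (Cons a u)
    then obtain b v' where v: "v = b # v'" by (cases v) auto
    then have "a = b"
      using Cons.prems step(2) by (auto dest: bij_is_inj injD)
    then show ?case using Cons v step(1) by auto
  qed
  then show "inj (act M q)" by (rule injI)
  have "\<exists>u. act M q u = v" for v
    using assms
  proof (induction v arbitrary: q)
    case Nil
    show ?case by (rule exI[of _ "[]"]) simp
  next
    case (Cons b v)
    obtain a where "production M q a = b"
      using step(2)[OF Cons.prems] by (metis bij_pointE)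
    moreover obtain u where "act M (transition M q a) u = v"
      using Cons.IH step(1)[OF Cons.prems] by blast
    ultimately show ?case by (intro exI[of _ "a # u"]) simp
  qed
  then show "surj (act M q)" unfolding surj_def by metis
qed

lemma act_in_Bij: "act M ` states M \<subseteq> carrier (BijGroup UNIV)"
  using bij_act by (auto simp: BijGroup_def Bij_def)

lemma carrier_eq_generate: "G = generate (BijGroup UNIV) (act M ` states M)"
  using act_in_Bij by (simp add: mealy_group_def carrier_subgroup_generated Int_absorb1)

lemma G_bij: "g \<in> G \<Longrightarrow> bij g"
  using group.carrier_subgroup_generated_subset[OF group_BijGroup, of UNIV "act M ` states M"]
  by (auto simp: mealy_group_def BijGroup_def Bij_def)

lemma group_mealy: "group (mealy_group M)"
  by (simp add: mealy_group_def group.group_subgroup_generated group_BijGroup)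

lemma one_eq_id: "\<one>\<^bsub>mealy_group M\<^esub> = id"
  by (auto simp: mealy_group_def BijGroup_def)

lemma Bij_UNIV_iff: "f \<in> Bij UNIV \<longleftrightarrow> bij f"
  by (simp add: Bij_def)

lemma mult_eq_comp:
  assumes "g \<in> G" "h \<in> G"
  shows "g \<otimes>\<^bsub>mealy_group M\<^esub> h = g \<circ> h"
proof -
  have "g \<in> Bij UNIV" "h \<in> Bij UNIV"
    using assms G_bij by (simp_all add: Bij_UNIV_iff)
  then show ?thesis
    by (simp add: mealy_group_def BijGroup_def compose_def fun_eq_iff)
qed

lemma inv_BijGroup_UNIV: "bij g \<Longrightarrow> inv\<^bsub>BijGroup UNIV\<^esub> g = Hilbert_Choice.inv g"
  by (simp add: inv_BijGroup Bij_UNIV_iff fun_eq_iff)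

lemma inv_eq_inv:
  assumes "g \<in> G"
  shows "inv\<^bsub>mealy_group M\<^esub> g = Hilbert_Choice.inv g"
proof -
  have "inv\<^bsub>mealy_group M\<^esub> g = inv\<^bsub>BijGroup UNIV\<^esub> g"
    using assms group.inv_subgroup_generated[OF group_BijGroup] unfolding mealy_group_def by blast
  then show ?thesis using inv_BijGroup_UNIV G_bij[OF assms] by simp
qed

lemma id_in_G: "id \<in> G"
  using group.is_monoid[OF group_mealy] monoid.one_closed one_eq_id by metis

lemma comp_in_G: "g \<in> G \<Longrightarrow> h \<in> G \<Longrightarrow> g \<circ> h \<in> G"
  using group.is_monoid[OF group_mealy] monoid.m_closed mult_eq_comp by metis

lemma inv_in_G: "g \<in> G \<Longrightarrow> Hilbert_Choice.inv g \<in> G"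
  using group.inv_closed[OF group_mealy] inv_eq_inv by metis

text \<open>
  Induction over the group with the operations read as composition and inversion of functions:
  this is the form in which properties of tree automorphisms are naturally verified, whereas
  \<open>generate.induct\<close> speaks of the operations of the group of bijections.
\<close>

lemma G_induct [consumes 1, case_names one act inv comp]:
  assumes "g \<in> G" and one: "P id" and act: "\<And>q. q \<in> states M \<Longrightarrow> P (act M q)"
    and inv: "\<And>g. g \<in> G \<Longrightarrow> P g \<Longrightarrow> P (Hilbert_Choice.inv g)"
    and comp: "\<And>g h. g \<in> G \<Longrightarrow> h \<in> G \<Longrightarrow> P g \<Longrightarrow> P h \<Longrightarrow> P (g \<circ> h)"
  shows "P g"
proof -
  have "g \<in> generate (BijGroup UNIV) (act M ` states M)"
    using assms(1) carrier_eq_generate by simp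
  then show ?thesis
  proof (induction rule: generate.induct)
    case one
    have "\<one>\<^bsub>BijGroup UNIV\<^esub> = (id :: 'a list \<Rightarrow> 'a list)" by (auto simp: BijGroup_def)
    then show ?case using assms(2) by metis
  next
    case (incl h)
    then show ?case using act by auto
  next
    case (inv h)
    then have h: "h \<in> G" "P h" using act carrier_eq_generate by (auto intro: generate.incl)
    then have "inv\<^bsub>BijGroup UNIV\<^esub> h = Hilbert_Choice.inv h"
      using inv_BijGroup_UNIV[OF G_bij] by blast
    then show ?case using assms(4) h by metis
  next
    case (eng g h)
    then have gh: "g \<in> G" "h \<in> G" using carrier_eq_generate by auto
    then have "g \<otimes>\<^bsub>BijGroup UNIV\<^esub> h = g \<circ> h"
      using mult_eq_comp by (simp add: mealy_group_def)
    then show ?case using comp[OF gh] eng by metis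
  qed
qed

lemma G_length: "g \<in> G \<Longrightarrow> length (g w) = length w"
proof (induction arbitrary: w rule: G_induct)
  case (inv g)
  then show ?case
    by (metis G_bij bij_inv_eq_iff)
qed (auto simp: act_length)

text \<open>
  This is what makes \<open>state_at\<close> meaningful: the property of being self-similar within the group
  holds for the generators and passes to composites and inverses.  For an inverse, the state at
  \<open>v\<close> is the inverse of the state of the original element at the preimage of \<open>v\<close>.
\<close>

lemma G_section: "g \<in> G \<Longrightarrow> \<exists>h\<in>G. \<forall>w. g (v @ w) = g v @ h w"
proof (induction arbitrary: v rule: G_induct)
  case one
  show ?case using id_in_G by (intro bexI[of _ id]) auto
next
  case (act q)
  then show ?case
    using act_append[of q v] carrier_eq_generate by (auto intro: generate.incl)
next
  case (inv g)
  let ?u = "Hilbert_Choice.inv g v"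
  obtain h where h: "h \<in> G" "\<And>w. g (?u @ w) = g ?u @ h w"
    using inv by meson
  have "Hilbert_Choice.inv g (v @ w) = ?u @ Hilbert_Choice.inv h w" for w
  proof -
    have "g (?u @ Hilbert_Choice.inv h w) = v @ w"
      using h G_bij inv by (simp add: bij_is_surj surj_f_inv_f)
    then show ?thesis using G_bij inv by (metis bij_inv_eq_iff)
  qed
  then show ?case using h inv_in_G by blast
next
  case (comp g h)
  obtain h' where h': "h' \<in> G" "\<And>w. h (v @ w) = h v @ h' w" using comp by meson
  obtain g' where g': "g' \<in> G" "\<And>w. g (h v @ w) = g (h v) @ g' w" using comp by meson
  show ?case using h' g' comp_in_G[of g' h'] by (intro bexI[of _ "g' \<circ> h'"]) auto
qed

lemma state_at_eqI:
  assumes "h \<in> G" "\<And>w. g (v @ w) = g v @ h w"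
  shows "state_at M g v = h"
  unfolding state_at_def
proof (rule the_equality)
  fix h' assume "h' \<in> G \<and> (\<forall>w. g (v @ w) = g v @ h' w)"
  then have "h' w = h w" for w using assms(2)[of w] by simp
  then show "h' = h" by auto
qed (use assms in auto)

lemma state_at_props:
  assumes "g \<in> G"
  shows state_at_in_G: "state_at M g v \<in> G"
    and apply_append: "g (v @ w) = g v @ state_at M g v w"
  using G_section[OF assms, of v] state_at_eqI by metis+

lemma state_at_append:
  assumes "g \<in> G"
  shows "state_at M g (v @ u) = state_at M (state_at M g v) u"
proof (rule state_at_eqI)
  show "state_at M (state_at M g v) u \<in> G" using assms state_at_in_G by blast
  show "g ((v @ u) @ w) = g (v @ u) @ state_at M (state_at M g v) u w" for w
    using apply_append[OF assms, of v "u @ w"] apply_append[OF assms, of v u]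
      apply_append[OF state_at_in_G[OF assms], of v u w] by simp
qed

lemma state_at_id: "state_at M id v = id"
  using id_in_G by (intro state_at_eqI) auto

lemma state_at_Nil: "g \<in> G \<Longrightarrow> state_at M g [] = g"
  by (rule state_at_eqI) (use G_length[of g "[]"] in auto)

section \<open>Singular points through states along a fixed word\<close>

text \<open>
  \<open>boundary_act\<close> only reads off last letters; the whole prefix is recovered by induction, since
  the image of a longer prefix extends the image of the shorter one.
\<close>

lemma boundary_act_eq_iff:
  assumes g: "g \<in> G"
  shows "boundary_act g \<xi> = \<xi> \<longleftrightarrow> (\<forall>n. g (initial_word \<xi> n) = initial_word \<xi> n)"
proof
  assume fixed: "boundary_act g \<xi> = \<xi>"
  have "g (initial_word \<xi> n) = initial_word \<xi> n" for n
  proof (induction n)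
    case 0
    then show ?case using G_length[OF g, of "[]"] by simp
  next
    case (Suc n)
    let ?h = "state_at M g (initial_word \<xi> n)"
    have eq: "g (initial_word \<xi> (Suc n)) = initial_word \<xi> n @ ?h [\<xi> n]"
      using apply_append[OF g, of "initial_word \<xi> n" "[\<xi> n]"] Suc by simp
    have "length (?h [\<xi> n]) = 1" using G_length[OF state_at_in_G[OF g]] by simp
    then obtain c where c: "?h [\<xi> n] = [c]" by (auto simp: length_Suc_conv)
    have "\<xi> n = g (initial_word \<xi> (Suc n)) ! n"
      using fun_cong[OF fixed, of n] by (simp add: boundary_act_def)
    also have "\<dots> = c" unfolding eq c by (simp add: nth_append)
    finally show ?case using eq c by simp
  qed
  then show "\<forall>n. g (initial_word \<xi> n) = initial_word \<xi> n" by blast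
next
  assume fixed: "\<forall>n. g (initial_word \<xi> n) = initial_word \<xi> n"
  show "boundary_act g \<xi> = \<xi>"
  proof
    fix n
    have "boundary_act g \<xi> n = initial_word \<xi> (Suc n) ! n"
      using fixed by (simp only: boundary_act_def)
    then show "boundary_act g \<xi> n = \<xi> n" by (simp del: upt_Suc)
  qed
qed

lemma in_stabilizer_iff:
  "g \<in> stabilizer M \<xi> \<longleftrightarrow> g \<in> G \<and> (\<forall>n. g (initial_word \<xi> n) = initial_word \<xi> n)"
  using boundary_act_eq_iff by (auto simp: stabilizer_def)

lemma subgroup_stabilizer: "subgroup (stabilizer M \<xi>) (mealy_group M)"
proof (rule group.subgroupI[OF group_mealy])
  show "stabilizer M \<xi> \<subseteq> G" by (auto simp: stabilizer_def)
  show "stabilizer M \<xi> \<noteq> {}" using id_in_G in_stabilizer_iff[of id \<xi>] by auto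
  show "inv\<^bsub>mealy_group M\<^esub> g \<in> stabilizer M \<xi>" if "g \<in> stabilizer M \<xi>" for g
    using that inv_in_G[of g] inv_eq_inv[of g] G_bij[of g]
    by (auto simp: in_stabilizer_iff) (metis bij_inv_eq_iff)
  show "g \<otimes>\<^bsub>mealy_group M\<^esub> h \<in> stabilizer M \<xi>"
    if "g \<in> stabilizer M \<xi>" "h \<in> stabilizer M \<xi>" for g h
    using that comp_in_G[of g h] mult_eq_comp[of g h] by (auto simp: in_stabilizer_iff)
qed

text \<open>
  Since \<open>g\<close> fixes the initial word, its action on the cylinder below is that of its state there.
  Every finite word occurs below the initial word as part of some infinite word, so fixing all
  infinite words of the cylinder forces the state to be the identity on finite words.
\<close>

lemma fixes_cylinder_iff:
  assumes g: "g \<in> stabilizer M \<xi>"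
  shows "(\<forall>\<eta>. initial_word \<eta> n = initial_word \<xi> n \<longrightarrow> g \<in> stabilizer M \<eta>) \<longleftrightarrow>
         state_at M g (initial_word \<xi> n) = id" (is "?L \<longleftrightarrow> ?h = id")
proof
  have gG: "g \<in> G" and fixed: "\<And>n. g (initial_word \<xi> n) = initial_word \<xi> n"
    using g by (auto simp: in_stabilizer_iff)
  {
    assume L: ?L
    have "?h w = w" for w
    proof -
      \<comment> \<open>This realizes the finite word \<open>w\<close> inside an infinite word of the cylinder.\<close>
      define \<eta> where "\<eta> i = (if i < n then \<xi> i else if i < n + length w then w ! (i - n) else undefined)" for i
      have init: "initial_word \<eta> n = initial_word \<xi> n" by (simp add: \<eta>_def)
      have "initial_word \<eta> (n + length w) = initial_word \<xi> n @ w"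
        by (rule nth_equalityI) (auto simp: \<eta>_def nth_append)
      then have "g (initial_word \<xi> n @ w) = initial_word \<xi> n @ w"
        using L init by (metis in_stabilizer_iff)
      then show ?thesis using apply_append[OF gG, of "initial_word \<xi> n" w] fixed[of n] by simp
    qed
    then show "?h = id" by auto
  }
  {
    assume h: "?h = id"
    show ?L
    proof (intro allI impI)
      fix \<eta> assume init: "initial_word \<eta> n = initial_word \<xi> n"
      have "g (initial_word \<eta> m) = initial_word \<eta> m" for m
      proof (cases "m \<le> n")
        case True
        have "initial_word \<eta> m = take m (initial_word \<eta> n)" using True by (simp add: take_map)
        also have "\<dots> = initial_word \<xi> m" unfolding init using True by (simp add: take_map)
        finally have eq: "initial_word \<eta> m = initial_word \<xi> m" .
        show ?thesis unfolding eq by (rule fixed)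
      next
        case False
        then have "initial_word \<eta> m = initial_word \<eta> n @ map \<eta> [n..<m]"
          by (metis map_append le_add_diff_inverse nat_le_linear upt_add_eq_append zero_le)
        then show ?thesis
          using apply_append[OF gG, of "initial_word \<xi> n"] fixed[of n] h init by simp
      qed
      then show "g \<in> stabilizer M \<eta>" using gG by (simp add: in_stabilizer_iff)
    qed
  }
qed

text \<open>
  Being moved is witnessed by a prefix, so it is stable under small perturbations of the word.
\<close>

lemma non_fixed_open:
  assumes "g \<in> G" "g \<notin> stabilizer M \<xi>"
  shows "\<exists>n. \<forall>\<eta>. initial_word \<eta> n = initial_word \<xi> n \<longrightarrow> g \<notin> stabilizer M \<eta>"
  using assms by (metis in_stabilizer_iff)

lemma singular_iff:
  "\<xi> \<in> singular_points M \<longleftrightarrow>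
   (\<exists>g\<in>stabilizer M \<xi>. \<forall>n. state_at M g (initial_word \<xi> n) \<noteq> id)"
proof -
  have "\<xi> \<notin> singular_points M \<longleftrightarrow>
    (\<forall>g\<in>G. \<exists>n. \<forall>\<eta>. initial_word \<eta> n = initial_word \<xi> n \<longrightarrow>
       (g \<in> stabilizer M \<eta> \<longleftrightarrow> g \<in> stabilizer M \<xi>))"
    unfolding singular_points_def mem_Collect_eq not_not
      topcontinuous_at_subgroup_topology_iff boundary_neighbourhood_iff
    using subgroup_stabilizer by (simp add: boundary_topology_def)
  also have "\<dots> \<longleftrightarrow> (\<forall>g\<in>stabilizer M \<xi>. \<exists>n. state_at M g (initial_word \<xi> n) = id)"
    (is "?A \<longleftrightarrow> ?B")
  proof
    assume A: ?A
    show ?B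
    proof
      fix g assume g: "g \<in> stabilizer M \<xi>"
      then have "g \<in> G" by (simp add: in_stabilizer_iff)
      with A obtain n where "\<forall>\<eta>. initial_word \<eta> n = initial_word \<xi> n \<longrightarrow>
          (g \<in> stabilizer M \<eta> \<longleftrightarrow> g \<in> stabilizer M \<xi>)"
        by blast
      with g have "\<forall>\<eta>. initial_word \<eta> n = initial_word \<xi> n \<longrightarrow> g \<in> stabilizer M \<eta>"
        by blast
      then show "\<exists>n. state_at M g (initial_word \<xi> n) = id"
        using fixes_cylinder_iff[OF g] by blast
    qed
  next
    assume B: ?B
    show ?A
    proof
      fix g assume gG: "g \<in> G"
      show "\<exists>n. \<forall>\<eta>. initial_word \<eta> n = initial_word \<xi> n \<longrightarrow>
         (g \<in> stabilizer M \<eta> \<longleftrightarrow> g \<in> stabilizer M \<xi>)"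
      proof (cases "g \<in> stabilizer M \<xi>")
        case True
        then obtain n where "state_at M g (initial_word \<xi> n) = id" using B by blast
        then have "\<forall>\<eta>. initial_word \<eta> n = initial_word \<xi> n \<longrightarrow> g \<in> stabilizer M \<eta>"
          using fixes_cylinder_iff[OF True] by blast
        with True show ?thesis by blast
      next
        case False
        then show ?thesis using non_fixed_open[OF gG False] by blast
      qed
    qed
  qed
  finally show ?thesis by blast
qed

end

section \<open>Paths of the stable automaton\<close>

text \<open>
  A labelled path that is defined only from time \<open>n\<close> on and lives in a finite set can be replaced
  by one defined from time \<open>0\<close> on with the same labels at all large times.  Two equal states at
  times \<open>a < b\<close> close a cycle of length \<open>d = b - a\<close>; the new path follows this cycle up to time \<open>a\<close>,
  in the phase that makes it enter the old path at time \<open>a\<close>, and the old path thereafter.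
\<close>

lemma recurrent_path_realign:
  fixes h :: "nat \<Rightarrow> 's" and \<xi> :: "nat \<Rightarrow> 'a"
  assumes "finite S" and S: "\<And>i. n \<le> i \<Longrightarrow> h i \<in> S"
    and E: "\<And>i. n \<le> i \<Longrightarrow> (h i, \<xi> i, h (Suc i)) \<in> E"
  shows "\<exists>\<pi> \<eta>. (\<forall>i. \<pi> i \<in> S) \<and> (\<forall>i. (\<pi> i, \<eta> i, \<pi> (Suc i)) \<in> E) \<and> cofinal_words \<xi> \<eta>"
proof -
  have "\<not> inj_on h {n..}"
    using assms(1) S finite_subset[of "h ` {n..}" S] finite_imageD[of h "{n..}"] infinite_Ici by blast
  then obtain a b where ab: "n \<le> a" "a < b" "h a = h b"
    by (auto simp: inj_on_def) (metis linorder_neqE_nat)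
  define d where "d = b - a"
  have d: "0 < d" "b = a + d" using ab by (auto simp: d_def)
  \<comment> \<open>The time of the old path followed at time \<open>i\<close>.  For \<open>i < a\<close> this should be \<open>a\<close> plus the residue
    of \<open>i - a\<close> modulo \<open>d\<close>; adding the multiple \<open>a * d\<close> of \<open>d\<close> to \<open>i - a\<close> keeps it a natural number.\<close>
  define j where "j i = (if a \<le> i then i else a + (i + a * (d - 1)) mod d)" for i
  have jn: "n \<le> j i" for i using ab(1) by (auto simp: j_def)
  have jS: "h (j (Suc i)) = h (Suc (j i))" for i
  proof (cases "a \<le> i")
    case False
    define r where "r = (i + a * (d - 1)) mod d"
    have ji: "j i = a + r" using False by (simp add: j_def r_def)
    have r: "(Suc i + a * (d - 1)) mod d = Suc r mod d"
      by (simp add: r_def mod_Suc_eq)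
    \<comment> \<open>At \<open>Suc i = a\<close> the phase is \<open>0\<close>, so the cycle is left exactly at its starting state.\<close>
    have "h (j (Suc i)) = h (a + Suc r mod d)"
    proof (cases "Suc i = a")
      case True
      have "Suc i + a * (d - 1) = a * d" using True d(1) by (cases d) auto
      then have "Suc r mod d = 0" using r by simp
      then show ?thesis using True by (simp add: j_def)
    next
      case False
      then show ?thesis using \<open>\<not> a \<le> i\<close> r by (simp add: j_def)
    qed
    \<comment> \<open>Wrapping around the cycle is invisible because \<open>h a = h b\<close>.\<close>
    moreover have "h (a + Suc r mod d) = h (Suc (a + r))"
    proof (cases "Suc r = d")
      case True
      then show ?thesis using ab(3) d(2) by (metis add_Suc_right add_0_right mod_self)
    next
      case False
      then have "Suc r < d" using d(1) by (simp add: r_def Suc_lessI)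
      then show ?thesis by simp
    qed
    ultimately show ?thesis using ji by simp
  qed (simp add: j_def)
  have "(h (j i), \<xi> (j i), h (j (Suc i))) \<in> E" for i
    using E[OF jn] jS by simp
  moreover have "cofinal_words \<xi> (\<lambda>i. \<xi> (j i))"
    unfolding cofinal_words_def by (rule exI[of _ a]) (simp add: j_def)
  ultimately show ?thesis
    using S jn by (intro exI[of _ "\<lambda>i. h (j i)"] exI[of _ "\<lambda>i. \<xi> (j i)"]) auto
qed

context invertible_mealy
begin

lemma stable_edge_iff:
  assumes "K \<subseteq> G"
  shows "(g, a, h) \<in> edges (stable_automaton (nucleus_automaton M K) F) \<longleftrightarrow>
         g \<in> K \<and> g [a] = [a] \<and> state_at M g [a] = h"
proof -
  have "hd (g [a]) = a \<longleftrightarrow> g [a] = [a]" if "g \<in> K"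
  proof -
    have "length (g [a]) = 1" using G_length[of g "[a]"] assms that by auto
    then show ?thesis by (auto simp: length_Suc_conv)
  qed
  then show ?thesis by (auto simp: stable_automaton_def nucleus_automaton_def)
qed

text \<open>
  Along a fixed word every state has to reproduce the letter that it reads, which is what a
  transition of the stable automaton demands.
\<close>

lemma stable_edge_along_fixed_word:
  assumes "K \<subseteq> G" and g: "g \<in> stabilizer M \<xi>" and "state_at M g (initial_word \<xi> n) \<in> K"
  shows "(state_at M g (initial_word \<xi> n), \<xi> n, state_at M g (initial_word \<xi> (Suc n)))
         \<in> edges (stable_automaton (nucleus_automaton M K) F)"
proof -
  have gG: "g \<in> G" and fixed: "\<And>n. g (initial_word \<xi> n) = initial_word \<xi> n"
    using g by (auto simp: in_stabilizer_iff)
  have "state_at M g (initial_word \<xi> n) [\<xi> n] = [\<xi> n]"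
    using apply_append[OF gG, of "initial_word \<xi> n" "[\<xi> n]"] fixed[of n] fixed[of "Suc n"] by simp
  then show ?thesis
    using assms state_at_append[OF gG, of "initial_word \<xi> n" "[\<xi> n]"] by (simp add: stable_edge_iff)
qed

text \<open>
  The automaton is deterministic, so a path is determined by its first state and its label, and
  its states are the states of the first one along the label.
\<close>

lemma stable_path_start:
  assumes "K \<subseteq> G"
    and path: "\<And>i. (\<pi> i, \<eta> i, \<pi> (Suc i)) \<in> edges (stable_automaton (nucleus_automaton M K) F)"
  shows "\<pi> 0 \<in> stabilizer M \<eta> \<and> (\<forall>n. state_at M (\<pi> 0) (initial_word \<eta> n) = \<pi> n)"
proof -
  have e: "\<pi> i \<in> K" "\<pi> i [\<eta> i] = [\<eta> i]" "state_at M (\<pi> i) [\<eta> i] = \<pi> (Suc i)" for i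
    using path[of i] stable_edge_iff[OF assms(1)] by auto
  have G: "\<pi> 0 \<in> G" using e assms(1) by auto
  have "\<pi> 0 (initial_word \<eta> n) = initial_word \<eta> n \<and> state_at M (\<pi> 0) (initial_word \<eta> n) = \<pi> n" for n
  proof (induction n)
    case 0
    then show ?case using G_length[OF G, of "[]"] state_at_Nil[OF G] by simp
  next
    case (Suc n)
    then show ?case
      using e[of n] apply_append[OF G, of "initial_word \<eta> n" "[\<eta> n]"]
        state_at_append[OF G, of "initial_word \<eta> n" "[\<eta> n]"] by simp
  qed
  then show ?thesis using G by (simp add: in_stabilizer_iff)
qed

lemma trivial_state_persists:
  assumes "g \<in> G" "state_at M g (initial_word \<xi> n) = id" "n \<le> m"
  shows "state_at M g (initial_word \<xi> m) = id"
proof -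
  have "initial_word \<xi> m = initial_word \<xi> n @ map \<xi> [n..<m]"
    using assms(3) by (metis map_append le_add_diff_inverse upt_add_eq_append zero_le)
  then show ?thesis using assms state_at_append state_at_id by simp
qed

section \<open>Singular points and recognized words\<close>

text \<open>
  The realigned path stays among the states that the original one visits from some time on.
  These are nontrivial, so the acceptance condition holds at every time.
\<close>

lemma singular_cofinal_with_language:
  assumes K: "is_nucleus M K" and "\<xi> \<in> singular_points M"
  shows "\<exists>\<eta>\<in>buchi_language (stable_automaton (nucleus_automaton M K) (K - {id})). cofinal_words \<xi> \<eta>"
proof -
  let ?B = "stable_automaton (nucleus_automaton M K) (K - {id})"
  have KG: "K \<subseteq> G" "finite K" using K by (auto simp: is_nucleus_def)
  obtain g where g: "g \<in> stabilizer M \<xi>" and nontriv: "\<And>n. state_at M g (initial_word \<xi> n) \<noteq> id"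
    using assms(2) singular_iff by blast
  then obtain n where n: "\<And>v. n \<le> length v \<Longrightarrow> state_at M g v \<in> K"
    using K unfolding is_nucleus_def in_stabilizer_iff by meson
  have "\<exists>\<pi> \<eta>. (\<forall>i. \<pi> i \<in> K - {id}) \<and> (\<forall>i. (\<pi> i, \<eta> i, \<pi> (Suc i)) \<in> edges ?B) \<and> cofinal_words \<xi> \<eta>"
  proof (rule recurrent_path_realign[where h = "\<lambda>i. state_at M g (initial_word \<xi> i)" and n = n])
    show "finite (K - {id})" using KG by simp
    fix i assume "n \<le> i"
    then have "state_at M g (initial_word \<xi> i) \<in> K" using n by simp
    then show "state_at M g (initial_word \<xi> i) \<in> K - {id}" using nontriv by blast
    show "(state_at M g (initial_word \<xi> i), \<xi> i, state_at M g (initial_word \<xi> (Suc i))) \<in> edges ?B"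
      using stable_edge_along_fixed_word[OF KG(1) g] \<open>state_at M g (initial_word \<xi> i) \<in> K\<close> by blast
  qed
  then obtain \<pi> \<eta> where \<pi>: "\<And>i. \<pi> i \<in> K - {id}" "\<And>i. (\<pi> i, \<eta> i, \<pi> (Suc i)) \<in> edges ?B"
    and cof: "cofinal_words \<xi> \<eta>" by blast
  have "\<pi> 0 \<in> initial ?B" "\<exists>\<^sub>\<infinity>i. \<pi> i \<in> accepting ?B"
    using \<pi>(1) by (auto simp: stable_automaton_def nucleus_automaton_def)
  then have "\<eta> \<in> buchi_language ?B" unfolding buchi_language_def using \<pi>(2) by blast
  then show ?thesis using cof by blast
qed

text \<open>
  A path that once reached the identity would stay there and meet accepting states only
  finitely often.
\<close>

lemma language_singular:
  assumes K: "is_nucleus M K"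
    and "\<eta> \<in> buchi_language (stable_automaton (nucleus_automaton M K) (K - {id}))"
  shows "\<eta> \<in> singular_points M"
proof -
  let ?B = "stable_automaton (nucleus_automaton M K) (K - {id})"
  have KG: "K \<subseteq> G" using K by (auto simp: is_nucleus_def)
  obtain \<pi> where path: "\<And>i. (\<pi> i, \<eta> i, \<pi> (Suc i)) \<in> edges ?B" and acc: "\<exists>\<^sub>\<infinity>i. \<pi> i \<in> accepting ?B"
    using assms(2) unfolding buchi_language_def by blast
  have stab: "\<pi> 0 \<in> stabilizer M \<eta>" and st: "\<And>n. state_at M (\<pi> 0) (initial_word \<eta> n) = \<pi> n"
    using stable_path_start[where \<pi> = \<pi> and \<eta> = \<eta>, OF KG path] by blast+
  have "\<pi> n \<noteq> id" for n
  proof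
    assume "\<pi> n = id"
    obtain m where "n \<le> m" "\<pi> m \<noteq> id"
      using acc by (auto simp: INFM_nat_le stable_automaton_def)
    then show False
      using trivial_state_persists[of "\<pi> 0" \<eta> n m] stab st \<open>\<pi> n = id\<close> by (auto simp: in_stabilizer_iff)
  qed
  then show ?thesis unfolding singular_iff using stab st by (intro bexI[of _ "\<pi> 0"]) simp_all
qed

end

theorem theorem4p5:
  fixes M :: "('q, 'a::finite) mealy"
    and K :: "('a list \<Rightarrow> 'a list) set"
    and N :: "('a list \<Rightarrow> 'a list, 'a) mealy"
    and L :: "(nat \<Rightarrow> 'a) set"
  assumes "mealy_automaton M"
    and "mealy_invertible M"
    and "is_nucleus M K"
    and "N = nucleus_automaton M K"
    and "L = buchi_language (stable_automaton N (states N - {\<one>\<^bsub>mealy_group M\<^esub>}))"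
  shows "(\<forall>\<xi>\<in>singular_points M. \<exists>\<eta>\<in>L. cofinal_words \<xi> \<eta>)
       \<and> (\<forall>\<eta>\<in>L. \<eta> \<in> singular_points M)
       \<and> (L = {} \<longrightarrow> singular_points M = {})"
proof -
  interpret invertible_mealy M
    using assms(1,2) by unfold_locales
  have L: "L = buchi_language (stable_automaton (nucleus_automaton M K) (K - {id}))"
    using assms(4,5) one_eq_id by (simp add: nucleus_automaton_def)
  show ?thesis
    using singular_cofinal_with_language[OF assms(3)] language_singular[OF assms(3)]
    unfolding L by blast
qed

end
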